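(* Let $k\geq 1$ and let $G$ be a graph with $\delta(G)\geq k-1$, with $n$ vertices and $m$ edges. Then \[ \gamma_{\times k}^{r}(G)\geq \frac{3kn-2m}{2k+1}, \] with equality if and only if there exist a $(k-1)$-regular graph $H$ of order $\gamma_{\times k}^{r}(G)$ and a $k$-regular graph $F$ of order $n-\gamma_{\times k}^{r}(G)$ such that $G$ is isomorphic to $F\circ_{*k}H$.
   Context: All graphs are finite, simple and undirected. For a graph $G=(V,E)$ and $x\in V$, $N[x]$ is the closed neighborhood. For a graph $G$ with $\delta(G)\geq k-1$: a set $S\subseteq V$ is a $k$-tuple dominating set if $|N[x]\cap S|\geq k$ for all $x\in V$; it is a $k$-tuple restrained dominating set if moreover every vertex of $V-S$ has at least $k$ neighbors in $V-S$; $\gamma_{\times k}^{r}(G)$ is the minimum cardinality of such a set. For graphs $F$ and $H$ with $|V(H)|\geq k$, $F\circ_{*k}H$ denotes any graph obtained from the disjoint union of $F$ and $H$ by joining each vertex of $F$ to exactly $k$ vertices of $H$ (no other edges added). *)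

theory Defs
  imports Complex_Main
begin

text \<open>Finite, simple, undirected graphs, given by a vertex set and a set of two-element edges.
  The null graph is allowed.\<close>

datatype 'a ugraph = Graph (verts: "'a set") (edges: "'a set set")

definition simple_graph :: "'a ugraph \<Rightarrow> bool" where
  "simple_graph G \<longleftrightarrow> finite (verts G) \<and> (\<forall>e\<in>edges G. e \<subseteq> verts G \<and> card e = 2)"

definition neighbors :: "'a ugraph \<Rightarrow> 'a \<Rightarrow> 'a set" where
  "neighbors G x = {y \<in> verts G. {x, y} \<in> edges G}"

definition closed_neighbors :: "'a ugraph \<Rightarrow> 'a \<Rightarrow> 'a set" where
  "closed_neighbors G x = insert x (neighbors G x)"

definition degree :: "'a ugraph \<Rightarrow> 'a \<Rightarrow> nat" where
  "degree G x = card (neighbors G x)"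

text \<open>Only meaningful for a graph with at least one vertex.\<close>

definition min_degree :: "'a ugraph \<Rightarrow> nat" where
  "min_degree G = Min (degree G ` verts G)"

definition regular_graph :: "nat \<Rightarrow> 'a ugraph \<Rightarrow> bool" where
  "regular_graph r G \<longleftrightarrow> (\<forall>x\<in>verts G. degree G x = r)"

definition ugraph_iso :: "'a ugraph \<Rightarrow> 'b ugraph \<Rightarrow> bool" where
  "ugraph_iso G H \<longleftrightarrow> (\<exists>f. bij_betw f (verts G) (verts H) \<and>
     (\<forall>x\<in>verts G. \<forall>y\<in>verts G. {x, y} \<in> edges G \<longleftrightarrow> {f x, f y} \<in> edges H))"

definition k_tuple_dominating :: "nat \<Rightarrow> 'a ugraph \<Rightarrow> 'a set \<Rightarrow> bool" where
  "k_tuple_dominating k G S \<longleftrightarrow>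
     S \<subseteq> verts G \<and> (\<forall>x\<in>verts G. k \<le> card (closed_neighbors G x \<inter> S))"

definition k_tuple_restrained_dominating :: "nat \<Rightarrow> 'a ugraph \<Rightarrow> 'a set \<Rightarrow> bool" where
  "k_tuple_restrained_dominating k G S \<longleftrightarrow> k_tuple_dominating k G S \<and>
     (\<forall>x\<in>verts G - S. k \<le> card (neighbors G x \<inter> (verts G - S)))"

definition restrained_domination_number :: "nat \<Rightarrow> 'a ugraph \<Rightarrow> nat" where
  "restrained_domination_number k G = Min (card ` {S. k_tuple_restrained_dominating k G S})"

text \<open>The minimum ranges over a nonempty set: the whole vertex set qualifies as soon as the
  minimum degree is at least \<open>k - 1\<close>.\<close>

lemma k_tuple_restrained_dominating_verts:
  assumes "simple_graph G" and "k - 1 \<le> min_degree G"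
  shows "k_tuple_restrained_dominating k G (verts G)"
proof -
  have fin: "finite (verts G)"
    using assms(1) by (simp add: simple_graph_def)
  have "k \<le> card (closed_neighbors G x \<inter> verts G)" if x: "x \<in> verts G" for x
  proof -
    have "k - 1 \<le> degree G x"
      using assms(2) fin x unfolding min_degree_def by (meson Min_le finite_imageI imageI le_trans)
    moreover have "x \<notin> neighbors G x"
      using assms(1) by (force simp: simple_graph_def neighbors_def)
    moreover have "finite (neighbors G x)"
      using fin by (simp add: neighbors_def)
    moreover have "closed_neighbors G x \<inter> verts G = insert x (neighbors G x)"
      using x by (auto simp: closed_neighbors_def neighbors_def)
    ultimately show ?thesis
      by (simp add: degree_def)
  qed
  then show ?thesis
    by (simp add: k_tuple_restrained_dominating_def k_tuple_dominating_def)
qed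

text \<open>\<open>F \<circ>\<^sub>*\<^sub>k H\<close> stands for any one of a family of graphs, hence a predicate: \<open>K\<close> is the disjoint
  union of \<open>F\<close> and \<open>H\<close> together with a set \<open>J\<close> of edges between the two parts such that each vertex
  of \<open>F\<close> has exactly \<open>k\<close> neighbours in \<open>H\<close> along \<open>J\<close>.\<close>

definition is_k_join :: "nat \<Rightarrow> 'f ugraph \<Rightarrow> 'h ugraph \<Rightarrow> ('f + 'h) ugraph \<Rightarrow> bool" where
  "is_k_join k F H K \<longleftrightarrow> k \<le> card (verts H) \<and> verts K = verts F <+> verts H \<and>
     (\<exists>J \<subseteq> {{Inl u, Inr v} | u v. u \<in> verts F \<and> v \<in> verts H}.
        edges K = (`) Inl ` edges F \<union> (`) Inr ` edges H \<union> J \<and>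
        (\<forall>u\<in>verts F. card {v \<in> verts H. {Inl u, Inr v} \<in> J} = k))"

end

theory Submission
  imports Defs
begin

text \<open>Count edge ends with respect to a minimum \<open>k\<close>-tuple restrained dominating set \<open>S\<close>. Every vertex
  of \<open>S\<close> has at least \<open>k - 1\<close> neighbours in \<open>S\<close>, every vertex outside has at least \<open>k\<close> neighbours
  inside and at least \<open>k\<close> outside, and each crossing edge is seen once from either side. Hence
  \<open>2m \<ge> (k - 1)|S| + 3k(n - |S|)\<close>, with equality exactly when all these local bounds are attained,
  i.e. when \<open>G\<close> is the \<open>k\<close>-join of \<open>G[V - S]\<close> and \<open>G[S]\<close>.\<close>

section \<open>Counting edge ends across a vertex partition\<close>

lemma finite_neighbors: "simple_graph G \<Longrightarrow> finite (neighbors G x)"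
  by (simp add: simple_graph_def neighbors_def)

lemma singleton_notin_edges: "simple_graph G \<Longrightarrow> {x} \<notin> edges G"
  by (force simp: simple_graph_def)

lemma finite_edges:
  assumes "simple_graph G"
  shows "finite (edges G)"
proof (rule finite_subset)
  show "edges G \<subseteq> Pow (verts G)" "finite (Pow (verts G))"
    using assms by (auto simp: simple_graph_def)
qed

lemma degree_eq_card_incident_edges:
  assumes G: "simple_graph G" and x: "x \<in> verts G"
  shows "degree G x = card {e \<in> edges G. x \<in> e}"
proof -
  have "bij_betw (\<lambda>y. {x, y}) (neighbors G x) {e \<in> edges G. x \<in> e}"
    unfolding bij_betw_def
  proof
    show "inj_on (\<lambda>y. {x, y}) (neighbors G x)"
      by (auto simp: inj_on_def doubleton_eq_iff)
    show "(\<lambda>y. {x, y}) ` neighbors G x = {e \<in> edges G. x \<in> e}"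
    proof (intro equalityI subsetI)
      fix e assume "e \<in> {e \<in> edges G. x \<in> e}"
      then have e: "e \<in> edges G" "x \<in> e" "e \<subseteq> verts G" "card e = 2"
        using G by (auto simp: simple_graph_def)
      then obtain y where "e = {x, y}"
        by (auto simp: card_2_iff)
      with e show "e \<in> (\<lambda>y. {x, y}) ` neighbors G x"
        by (auto simp: neighbors_def)
    qed (auto simp: neighbors_def)
  qed
  then show ?thesis
    by (simp add: degree_def bij_betw_same_card)
qed

text \<open>Handshake by double counting of incidences: every edge contains exactly two vertices,
  and every vertex lies on as many edges as its degree.\<close>

lemma sum_degree_eq_twice_card_edges:
  assumes "simple_graph G"
  shows "(\<Sum>x\<in>verts G. degree G x) = 2 * card (edges G)"
proof -
  have "card {x \<in> verts G. x \<in> e} = 2" if "e \<in> edges G" for e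
  proof -
    have "{x \<in> verts G. x \<in> e} = e" "card e = 2"
      using assms that by (auto simp: simple_graph_def)
    then show ?thesis by simp
  qed
  then have "(\<Sum>x\<in>verts G. card {e \<in> edges G. x \<in> e}) = 2 * card (edges G)"
    using assms by (intro sum_multicount finite_edges) (auto simp: simple_graph_def)
  then show ?thesis
    using assms by (simp add: degree_eq_card_incident_edges)
qed

text \<open>Each degree splits into neighbours in \<open>S\<close> and neighbours outside. The
  crossing ends seen from \<open>S\<close> are exchanged for those seen from the complement, where
  the domination bounds apply; this is the source of the factor 2 on the last sum.\<close>

lemma twice_card_edges_split:
  assumes G: "simple_graph G" and S: "S \<subseteq> verts G"
  shows "2 * card (edges G) =
    (\<Sum>x\<in>S. card (neighbors G x \<inter> S)) +
    (\<Sum>x\<in>verts G - S. card (neighbors G x \<inter> (verts G - S))) +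
    2 * (\<Sum>x\<in>verts G - S. card (neighbors G x \<inter> S))"
proof -
  let ?T = "verts G - S"
  have fin: "finite (verts G)" "finite S"
    using G S finite_subset by (auto simp: simple_graph_def)
  have split: "degree G x = card (neighbors G x \<inter> S) + card (neighbors G x \<inter> ?T)" for x
  proof -
    have "neighbors G x = (neighbors G x \<inter> S) \<union> (neighbors G x \<inter> ?T)"
      by (auto simp: neighbors_def)
    then show ?thesis
      unfolding degree_def
      by (metis (no_types, lifting) Diff_disjoint G card_Un_disjoint finite_Int finite_neighbors
          inf.left_commute inf_assoc inf_bot_right)
  qed
  have cross: "(\<Sum>x\<in>S. card (neighbors G x \<inter> ?T)) = (\<Sum>x\<in>?T. card (neighbors G x \<inter> S))"
  proof -
    have "(\<Sum>x\<in>S. card {y \<in> ?T. {x, y} \<in> edges G}) = (\<Sum>y\<in>?T. card {x \<in> S. {x, y} \<in> edges G})"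
      using fin by (intro sum_multicount_gen) auto
    moreover have "neighbors G x \<inter> ?T = {y \<in> ?T. {x, y} \<in> edges G}" for x
      by (auto simp: neighbors_def)
    moreover have "neighbors G y \<inter> S = {x \<in> S. {x, y} \<in> edges G}" for y
      using S by (auto simp: neighbors_def insert_commute)
    ultimately show ?thesis by simp
  qed
  have "2 * card (edges G) = (\<Sum>x\<in>verts G. degree G x)"
    using sum_degree_eq_twice_card_edges[OF G] by simp
  also have "\<dots> = (\<Sum>x\<in>?T. degree G x) + (\<Sum>x\<in>S. degree G x)"
    using fin S by (rule_tac sum.subset_diff)
  finally show ?thesis
    using cross by (simp add: split sum.distrib)
qed

section \<open>The lower bound on the number of edges and its equality case\<close>

text \<open>This is the structure of a regular join as seen inside \<open>G\<close>:
  \<open>S\<close> plays the role of \<open>H\<close> and its complement that of \<open>F\<close>.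
  It mediates between the numerical equality and the isomorphism.\<close>

definition tight_partition :: "nat \<Rightarrow> 'a ugraph \<Rightarrow> 'a set \<Rightarrow> bool" where
  "tight_partition k G S \<longleftrightarrow> S \<subseteq> verts G \<and> (\<forall>x\<in>S. card (neighbors G x \<inter> S) = k - 1) \<and>
     (\<forall>x\<in>verts G - S. card (neighbors G x \<inter> (verts G - S)) = k \<and> card (neighbors G x \<inter> S) = k)"

lemma card_edges_tight_partition:
  assumes "simple_graph G" and "tight_partition k G S"
  shows "2 * card (edges G) = (k - 1) * card S + 3 * k * card (verts G - S)"
  using assms by (subst twice_card_edges_split[of G S]) (auto simp: tight_partition_def)

text \<open>A vertex of \<open>S\<close> counts itself among the \<open>k\<close> elements of
  \<open>S\<close> in its closed neighbourhood, so only \<open>k - 1\<close> neighbours are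
  guaranteed. A vertex outside \<open>S\<close> loses nothing.\<close>

lemma restrained_dominating_neighbor_bounds:
  assumes G: "simple_graph G" and S: "k_tuple_restrained_dominating k G S"
  shows "S \<subseteq> verts G"
    and "x \<in> S \<Longrightarrow> k - 1 \<le> card (neighbors G x \<inter> S)"
    and "x \<in> verts G - S \<Longrightarrow> k \<le> card (neighbors G x \<inter> (verts G - S))"
    and "x \<in> verts G - S \<Longrightarrow> k \<le> card (neighbors G x \<inter> S)"
proof -
  show sub: "S \<subseteq> verts G"
    and "x \<in> verts G - S \<Longrightarrow> k \<le> card (neighbors G x \<inter> (verts G - S))"
    using S by (auto simp: k_tuple_restrained_dominating_def k_tuple_dominating_def)
  have dom: "k \<le> card (insert x (neighbors G x) \<inter> S)" if "x \<in> verts G"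
    using S that
    by (auto simp: k_tuple_restrained_dominating_def k_tuple_dominating_def closed_neighbors_def)
  show "x \<in> verts G - S \<Longrightarrow> k \<le> card (neighbors G x \<inter> S)"
    using dom by simp
  have "card (insert x (neighbors G x \<inter> S)) \<le> Suc (card (neighbors G x \<inter> S))"
    by (rule card_insert_le_m1) auto
  then show "x \<in> S \<Longrightarrow> k - 1 \<le> card (neighbors G x \<inter> S)"
    using dom sub by auto
qed

text \<open>Summing the local bounds gives the inequality. If the totals agree, each of the three
  sums meets its bound, and a termwise inequality between equal finite sums is an equality in every
  term.\<close>

lemma card_edges_restrained_dominating:
  assumes G: "simple_graph G" and S: "k_tuple_restrained_dominating k G S"
  shows "(k - 1) * card S + 3 * k * card (verts G - S) \<le> 2 * card (edges G)"
    and "2 * card (edges G) = (k - 1) * card S + 3 * k * card (verts G - S) \<Longrightarrow>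
      tight_partition k G S"
proof -
  let ?T = "verts G - S"
  note b = restrained_dominating_neighbor_bounds[OF G S]
  have fin: "finite S" "finite ?T"
    using G b(1) finite_subset by (auto simp: simple_graph_def)
  have 1: "(\<Sum>x\<in>S. k - 1) \<le> (\<Sum>x\<in>S. card (neighbors G x \<inter> S))"
    and 2: "(\<Sum>x\<in>?T. k) \<le> (\<Sum>x\<in>?T. card (neighbors G x \<inter> ?T))"
    and 3: "(\<Sum>x\<in>?T. k) \<le> (\<Sum>x\<in>?T. card (neighbors G x \<inter> S))"
    using b by (auto intro!: sum_mono simp del: sum_constant)
  \<comment> \<open>The coefficient \<open>3 * k\<close> is \<open>k\<close> for ends inside the
    complement plus \<open>2 * k\<close> for crossing edges, whose ends are counted on both
    sides.\<close>
  have total: "(k - 1) * card S + 3 * k * card ?T = (\<Sum>x\<in>S. k - 1) + (\<Sum>x\<in>?T. k) + 2 * (\<Sum>x\<in>?T. k)"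
    by simp
  show "(k - 1) * card S + 3 * k * card ?T \<le> 2 * card (edges G)"
    unfolding total twice_card_edges_split[OF G b(1)] using 1 2 3 by linarith
  assume "2 * card (edges G) = (k - 1) * card S + 3 * k * card ?T"
  then have "(\<Sum>x\<in>S. k - 1) = (\<Sum>x\<in>S. card (neighbors G x \<inter> S))"
    and "(\<Sum>x\<in>?T. k) = (\<Sum>x\<in>?T. card (neighbors G x \<inter> ?T))"
    and "(\<Sum>x\<in>?T. k) = (\<Sum>x\<in>?T. card (neighbors G x \<inter> S))"
    unfolding total twice_card_edges_split[OF G b(1)] using 1 2 3 by linarith+
  note eqs = this
  have "k - 1 = card (neighbors G x \<inter> S)" if "x \<in> S" for x
    by (rule sum_mono_inv[OF eqs(1)]) (use that b fin in auto)
  moreover have "k = card (neighbors G x \<inter> ?T)" if "x \<in> ?T" for x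
    by (rule sum_mono_inv[OF eqs(2)]) (use that b fin in auto)
  moreover have "k = card (neighbors G x \<inter> S)" if "x \<in> ?T" for x
    by (rule sum_mono_inv[OF eqs(3)]) (use that b fin in auto)
  ultimately show "tight_partition k G S"
    using b(1) by (simp add: tight_partition_def)
qed

section \<open>From a join to a tight partition\<close>

lemma ugraph_iso_sym:
  assumes "ugraph_iso G H"
  shows "ugraph_iso H G"
proof -
  obtain f where f: "bij_betw f (verts G) (verts H)"
    and e: "\<And>x y. x \<in> verts G \<Longrightarrow> y \<in> verts G \<Longrightarrow> {x, y} \<in> edges G \<longleftrightarrow> {f x, f y} \<in> edges H"
    using assms by (auto simp: ugraph_iso_def)
  let ?g = "inv_into (verts G) f"
  have g: "bij_betw ?g (verts H) (verts G)"
    using f by (rule bij_betw_inv_into)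
  have "{x, y} \<in> edges H \<longleftrightarrow> {?g x, ?g y} \<in> edges G" if "x \<in> verts H" "y \<in> verts H" for x y
    using that e[of "?g x" "?g y"] bij_betwE[OF g] bij_betw_inv_into_right[OF f] by simp
  with g show ?thesis
    by (auto simp: ugraph_iso_def)
qed

text \<open>The tags \<open>Inl\<close> and \<open>Inr\<close> of the two ends tell which of the
  three families an edge of the join can come from.\<close>

lemma edges_join_iff:
  assumes "edges K = (`) Inl ` A \<union> (`) Inr ` B \<union> J"
    and "J \<subseteq> {{Inl u, Inr v} | u v. P u v}"
  shows "{Inl u, Inl u'} \<in> edges K \<longleftrightarrow> {u, u'} \<in> A"
    and "{Inr v, Inr v'} \<in> edges K \<longleftrightarrow> {v, v'} \<in> B"
    and "{Inl u, Inr v} \<in> edges K \<longleftrightarrow> {Inl u, Inr v} \<in> J"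
proof -
  have l: "{Inl u, Inl u'} = Inl ` {u, u'}" and r: "{Inr v, Inr v'} = Inr ` {v, v'}"
    by auto
  have J: "\<exists>u v. e = {Inl u, Inr v}" if "e \<in> J" for e
    using that assms(2) by blast
  have "{Inl u, Inl u'} \<notin> J" "{Inr v, Inr v'} \<notin> J"
    by (auto dest!: J simp: doubleton_eq_iff)
  moreover have "Inl ` {u, u'} \<notin> (`) Inr ` B" "Inr ` {v, v'} \<notin> (`) Inl ` A"
    by (auto simp: set_eq_iff)
  moreover have "{Inl u, Inr v} \<notin> (`) Inl ` A" "{Inl u, Inr v} \<notin> (`) Inr ` B"
    by auto
  ultimately show "{Inl u, Inl u'} \<in> edges K \<longleftrightarrow> {u, u'} \<in> A"
    and "{Inr v, Inr v'} \<in> edges K \<longleftrightarrow> {v, v'} \<in> B"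
    and "{Inl u, Inr v} \<in> edges K \<longleftrightarrow> {Inl u, Inr v} \<in> J"
    by (auto simp: assms(1) l r inj_image_eq_iff image_iff simp del: image_insert image_empty)
qed

text \<open>The witness is the image of \<open>H\<close> under the isomorphism. Its neighbour counts
  are governed by the edges of \<open>H\<close>, those of the complement by the edges of
  \<open>F\<close>, and the crossing ones by \<open>J\<close>.\<close>

lemma tight_partition_of_join:
  assumes "is_k_join k F H K" and "ugraph_iso G K"
    and "regular_graph (k - 1) H" and "regular_graph k F"
  shows "\<exists>S. tight_partition k G S \<and> card S = card (verts H)"
proof -
  obtain J where V: "verts K = verts F <+> verts H"
    and J: "J \<subseteq> {{Inl u, Inr v} | u v. u \<in> verts F \<and> v \<in> verts H}"
    and E: "edges K = (`) Inl ` edges F \<union> (`) Inr ` edges H \<union> J"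
    and Jk: "\<And>u. u \<in> verts F \<Longrightarrow> card {v \<in> verts H. {Inl u, Inr v} \<in> J} = k"
    using assms(1) unfolding is_k_join_def by (elim conjE exE) (rule that; (assumption | erule (1) bspec))
  obtain p where p: "bij_betw p (verts K) (verts G)"
    and e: "\<And>x y. x \<in> verts K \<Longrightarrow> y \<in> verts K \<Longrightarrow> {x, y} \<in> edges K \<longleftrightarrow> {p x, p y} \<in> edges G"
    using ugraph_iso_sym[OF assms(2)] by (auto simp: ugraph_iso_def)
  let ?l = "\<lambda>u. p (Inl u)" and ?r = "\<lambda>v. p (Inr v)"
  define S where "S = ?r ` verts H"
  have inj: "inj_on p (verts F <+> verts H)" and im: "p ` (verts F <+> verts H) = verts G"
    using p by (auto simp: bij_betw_def V)
  have il: "inj_on ?l (verts F)" and ir: "inj_on ?r (verts H)"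
    using inj by (auto simp: inj_on_def)
  \<comment> \<open>Injectivity of \<open>p\<close> keeps the images of the two parts disjoint, so
    the complement of \<open>S\<close> is exactly the image of \<open>F\<close>.\<close>
  have T: "verts G - S = ?l ` verts F"
    using inj unfolding S_def im[symmetric] by (auto simp: inj_on_def)
  have S: "S \<subseteq> verts G"
    unfolding S_def im[symmetric] by auto
  note ej = edges_join_iff[OF E J]
  have lu: "?l u \<in> verts G" if "u \<in> verts F" for u
    unfolding im[symmetric] using that by auto
  have ru: "?r v \<in> verts G" if "v \<in> verts H" for v
    unfolding im[symmetric] using that by auto
  have "card (neighbors G (?r v) \<inter> S) = k - 1" if v: "v \<in> verts H" for v
  proof -
    have "neighbors G (?r v) \<inter> S = ?r ` neighbors H v"
      using v ru e[of "Inr v" "Inr _"] by (auto simp: S_def neighbors_def V ej)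
    moreover have "inj_on ?r (neighbors H v)"
      using ir by (rule inj_on_subset) (auto simp: neighbors_def)
    ultimately show ?thesis
      using assms(3) v by (simp add: card_image regular_graph_def degree_def)
  qed
  moreover have "card (neighbors G (?l u) \<inter> (verts G - S)) = k" if u: "u \<in> verts F" for u
  proof -
    have "neighbors G (?l u) \<inter> (verts G - S) = ?l ` neighbors F u"
      unfolding T using u lu e[of "Inl u" "Inl _"] by (auto simp: neighbors_def V ej)
    moreover have "inj_on ?l (neighbors F u)"
      using il by (rule inj_on_subset) (auto simp: neighbors_def)
    ultimately show ?thesis
      using assms(4) u by (simp add: card_image regular_graph_def degree_def)
  qed
  moreover have "card (neighbors G (?l u) \<inter> S) = k" if u: "u \<in> verts F" for u
  proof -
    have "neighbors G (?l u) \<inter> S = ?r ` {v \<in> verts H. {Inl u, Inr v} \<in> J}"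
      using u ru e[of "Inl u" "Inr _"] by (auto simp: S_def neighbors_def V ej)
    moreover have "inj_on ?r {v \<in> verts H. {Inl u, Inr v} \<in> J}"
      using ir by (rule inj_on_subset) auto
    ultimately show ?thesis
      using Jk[OF u] by (simp add: card_image)
  qed
  ultimately have "tight_partition k G S"
    using S unfolding tight_partition_def T by (auto simp: S_def)
  moreover have "card S = card (verts H)"
    using ir by (simp add: S_def card_image)
  ultimately show ?thesis by blast
qed

section \<open>From a tight partition to a join\<close>

text \<open>For a bijection \<open>p\<close> from \<open>A\<close> onto a set \<open>X\<close> of
  vertices, this is a copy of the induced subgraph on \<open>X\<close>. It moves the two parts of
  \<open>G\<close> to vertices of type \<open>nat\<close>, whatever the vertex type of
  \<open>G\<close>.\<close>

definition pullback_graph :: "('b \<Rightarrow> 'a) \<Rightarrow> 'b set \<Rightarrow> 'a ugraph \<Rightarrow> 'b ugraph" where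
  "pullback_graph p A G = Graph A {{a, b} | a b. a \<in> A \<and> b \<in> A \<and> {p a, p b} \<in> edges G}"

lemma verts_pullback_graph [simp]: "verts (pullback_graph p A G) = A"
  by (simp add: pullback_graph_def)

lemma edges_pullback_graph_iff:
  "{a, b} \<in> edges (pullback_graph p A G) \<longleftrightarrow> a \<in> A \<and> b \<in> A \<and> {p a, p b} \<in> edges G"
  by (auto simp: pullback_graph_def doubleton_eq_iff insert_commute)

lemma simple_pullback_graph:
  assumes "simple_graph G" and "finite A"
  shows "simple_graph (pullback_graph p A G)"
proof -
  have "card {a, b} = 2" if "{p a, p b} \<in> edges G" for a b
    using that singleton_notin_edges[OF assms(1), of "p b"] by (cases "a = b") auto
  then show ?thesis
    using assms(2) by (auto simp: simple_graph_def pullback_graph_def)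
qed

text \<open>Since \<open>p\<close> matches neighbours in the copy with neighbours inside
  \<open>X\<close>, the clauses of \<open>tight_partition\<close> about a single part become
  regularity of its copy.\<close>

lemma degree_pullback_graph:
  assumes p: "bij_betw p A X" and X: "X \<subseteq> verts G" and a: "a \<in> A"
  shows "degree (pullback_graph p A G) a = card (neighbors G (p a) \<inter> X)"
proof -
  have "neighbors G (p a) \<inter> X = p ` neighbors (pullback_graph p A G) a"
    using p X a by (auto simp: neighbors_def edges_pullback_graph_iff bij_betw_def)
  moreover have "inj_on p (neighbors (pullback_graph p A G) a)"
    using p by (auto simp: bij_betw_def neighbors_def intro: inj_on_subset)
  ultimately show ?thesis
    by (simp add: degree_def card_image)
qed

text \<open>Number the two parts, copy the induced subgraphs, and let \<open>J\<close> consist of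
  the crossing edges of \<open>G\<close>. Gluing the two numberings gives the isomorphism. The bound
  on \<open>card S\<close> supplies the size condition on \<open>H\<close> in
  \<open>is_k_join\<close>.\<close>

lemma join_of_tight_partition:
  assumes G: "simple_graph G" and t: "tight_partition k G S" and k: "k \<le> card S"
  shows "\<exists>(H :: nat ugraph) (F :: nat ugraph) K.
    simple_graph H \<and> regular_graph (k - 1) H \<and> card (verts H) = card S \<and>
    simple_graph F \<and> regular_graph k F \<and> card (verts F) = card (verts G - S) \<and>
    is_k_join k F H K \<and> ugraph_iso G K"
proof -
  let ?T = "verts G - S"
  have S: "S \<subseteq> verts G"
    using t by (simp add: tight_partition_def)
  then have fin: "finite S" "finite ?T"
    using G finite_subset by (auto simp: simple_graph_def)
  define A where "A = {0..<card S}"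
  define B where "B = {0..<card ?T}"
  obtain q p where q: "bij_betw q A S" and p: "bij_betw p B ?T"
    using ex_bij_betw_nat_finite fin unfolding A_def B_def by metis
  define H where "H = pullback_graph q A G"
  define F where "F = pullback_graph p B G"
  define J where "J = {{Inl u, Inr v} | u v. u \<in> B \<and> v \<in> A \<and> {p u, q v} \<in> edges G}"
  define K where "K = Graph (B <+> A) ((`) Inl ` edges F \<union> (`) Inr ` edges H \<union> J)"
  have VF: "verts F = B" and VH: "verts H = A" and VK: "verts K = B <+> A"
    by (simp_all add: F_def H_def K_def)
  have J: "J \<subseteq> {{Inl u, Inr v} | u v. u \<in> B \<and> v \<in> A}"
    by (auto simp: J_def)
  have J_iff: "{Inl u, Inr v} \<in> J \<longleftrightarrow> u \<in> B \<and> v \<in> A \<and> {p u, q v} \<in> edges G" for u v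
    by (auto simp: J_def doubleton_eq_iff)
  have EK: "edges K = (`) Inl ` edges F \<union> (`) Inr ` edges H \<union> J"
    by (simp add: K_def)
  have qA: "q v \<in> S" if "v \<in> A" for v
    using q that by (rule bij_betw_apply)
  have pB: "p u \<in> ?T" if "u \<in> B" for u
    using p that by (rule bij_betw_apply)
  \<comment> \<open>The numberings have disjoint ranges, which makes \<open>case_sum p q\<close>
    injective.\<close>
  have ne: "p u \<noteq> q v" if "u \<in> B" "v \<in> A" for u v
    using pB[OF that(1)] qA[OF that(2)] by auto
  have "regular_graph (k - 1) H" "regular_graph k F"
    using t qA pB degree_pullback_graph[OF q S] degree_pullback_graph[OF p, of G]
    by (auto simp: regular_graph_def H_def F_def tight_partition_def)
  moreover have "is_k_join k F H K"
    unfolding is_k_join_def VF VH VK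
  proof (intro conjI exI[of _ J] J EK ballI)
    show "k \<le> card A"
      using k by (simp add: A_def)
    fix u assume u: "u \<in> B"
    have "neighbors G (p u) \<inter> S = q ` {v \<in> A. {Inl u, Inr v} \<in> J}"
      using q S u by (auto simp: J_iff neighbors_def bij_betw_def)
    moreover have "inj_on q {v \<in> A. {Inl u, Inr v} \<in> J}"
      using q by (auto simp: bij_betw_def intro: inj_on_subset)
    ultimately have "card {v \<in> A. {Inl u, Inr v} \<in> J} = card (neighbors G (p u) \<inter> S)"
      by (simp only: card_image)
    also have "\<dots> = k"
      using t pB[OF u] by (simp add: tight_partition_def)
    finally show "card {v \<in> A. {Inl u, Inr v} \<in> J} = k" .
  qed simp
  moreover have "ugraph_iso K G"
    unfolding ugraph_iso_def VK
  proof (intro exI[of _ "case_sum p q"] conjI ballI)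
    show "bij_betw (case_sum p q) (B <+> A) (verts G)"
      unfolding bij_betw_def
    proof
      show "inj_on (case_sum p q) (B <+> A)"
        using ne ne[THEN not_sym]
        by (intro inj_onI)
          (auto dest: inj_onD[OF bij_betw_imp_inj_on[OF p]] inj_onD[OF bij_betw_imp_inj_on[OF q]])
      have "case_sum p q ` (B <+> A) = p ` B \<union> q ` A"
        by (force simp: image_iff)
      then show "case_sum p q ` (B <+> A) = verts G"
        using p q S by (auto simp: bij_betw_def)
    qed
    note ej = edges_join_iff[OF EK J]
    fix x y assume "x \<in> B <+> A" "y \<in> B <+> A"
    \<comment> \<open>\<open>ej(3)\<close> and \<open>J_iff\<close> treat crossing pairs with the
      \<open>Inl\<close> end first; the instances of \<open>insert_commute\<close> bring the
      opposite order into that form.\<close>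
    then show "{x, y} \<in> edges K \<longleftrightarrow> {case_sum p q x, case_sum p q y} \<in> edges G"
      using ej(3)
      by (elim PlusE) (auto simp: ej(1,2) J_iff F_def H_def edges_pullback_graph_iff
          insert_commute[of "Inr _" "Inl _"] insert_commute[of "q _" "p _"])
  qed
  moreover have "simple_graph H" "simple_graph F"
    using G by (auto simp: H_def F_def A_def B_def intro: simple_pullback_graph)
  ultimately show ?thesis
    using ugraph_iso_sym[of K G] VF VH unfolding A_def B_def by (metis card_atLeastLessThan diff_zero)
qed

section \<open>Minimum sets and the final comparison\<close>

text \<open>The candidates form a finite family that contains \<open>verts G\<close>, so
  \<open>Min\<close> is attained.\<close>

lemma obtain_minimum_restrained_dominating:
  assumes "simple_graph G" and "k - 1 \<le> min_degree G"
  obtains S where "k_tuple_restrained_dominating k G S"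
    and "card S = restrained_domination_number k G"
proof -
  let ?D = "{S. k_tuple_restrained_dominating k G S}"
  have "?D \<subseteq> Pow (verts G)"
    by (auto simp: k_tuple_restrained_dominating_def k_tuple_dominating_def)
  moreover have "finite (verts G)"
    using assms(1) by (simp add: simple_graph_def)
  ultimately have "finite ?D"
    by (meson finite_Pow_iff finite_subset)
  moreover have "?D \<noteq> {}"
    using k_tuple_restrained_dominating_verts[OF assms] by blast
  ultimately have "restrained_domination_number k G \<in> card ` ?D"
    unfolding restrained_domination_number_def by (intro Min_in) auto
  then show ?thesis
    using that by force
qed


theorem theorem3p3:
  fixes G :: "'a ugraph" and k n m :: nat
  assumes "k \<ge> 1"
    and "simple_graph G" and "verts G \<noteq> {}"
    and "min_degree G \<ge> k - 1"
    and "n = card (verts G)" and "m = card (edges G)"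
  shows "real (restrained_domination_number k G)
           \<ge> (3 * real k * real n - 2 * real m) / (2 * real k + 1) \<and>
         (real (restrained_domination_number k G)
           = (3 * real k * real n - 2 * real m) / (2 * real k + 1) \<longleftrightarrow>
          (\<exists>(H :: nat ugraph) (F :: nat ugraph) K.
             simple_graph H \<and> regular_graph (k - 1) H \<and>
             card (verts H) = restrained_domination_number k G \<and>
             simple_graph F \<and> regular_graph k F \<and>
             card (verts F) = n - restrained_domination_number k G \<and>
             is_k_join k F H K \<and> ugraph_iso G K))"
proof -
  let ?\<gamma> = "restrained_domination_number k G"
  obtain S where S: "k_tuple_restrained_dominating k G S" and card_S: "card S = ?\<gamma>"
    using obtain_minimum_restrained_dominating assms(2,4) by blast
  have fin: "finite (verts G)"
    using assms(2) by (simp add: simple_graph_def)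
  have sub: "S \<subseteq> verts G"
    using restrained_dominating_neighbor_bounds(1)[OF assms(2) S] .
  then have \<gamma>_le: "?\<gamma> \<le> n"
    using fin card_S assms(5) card_mono by metis
  have card_T: "card (verts G - X) = n - ?\<gamma>" if "X \<subseteq> verts G" "card X = ?\<gamma>" for X
    using that fin assms(5) by (metis card_Diff_subset finite_subset)
  \<comment> \<open>Here nonemptiness of \<open>G\<close> enters: the closed neighbourhood of any
    one vertex already contains \<open>k\<close> elements of \<open>S\<close>.\<close>
  have k_le: "k \<le> card S"
  proof -
    obtain x where "x \<in> verts G"
      using assms(3) by blast
    then have "k \<le> card (closed_neighbors G x \<inter> S)"
      using S by (simp add: k_tuple_restrained_dominating_def k_tuple_dominating_def)
    also have "\<dots> \<le> card S"
      using fin sub by (meson card_mono finite_subset inf_le2)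
    finally show ?thesis .
  qed
  \<comment> \<open>\<open>b\<close> is the lower bound for \<open>2 * m\<close>. Collecting the
    terms in \<open>?\<gamma>\<close> gives the coefficient
    \<open>(k - 1) - 3 * k = -(2 * k + 1)\<close>, hence the denominator of the theorem. The natural
    subtractions are genuine because \<open>k \<ge> 1\<close> and
    \<open>?\<gamma> \<le> n\<close>.\<close>
  define b where "b = (k - 1) * ?\<gamma> + 3 * k * (n - ?\<gamma>)"
  have b: "real b = 3 * real k * real n - (2 * real k + 1) * real ?\<gamma>"
    using assms(1) \<gamma>_le by (simp add: b_def of_nat_diff
        left_diff_distrib right_diff_distrib distrib_right)
  have b_le: "b \<le> 2 * m"
    and tight: "2 * m = b \<Longrightarrow> tight_partition k G S"
    using card_edges_restrained_dominating[OF assms(2) S] card_T[OF sub card_S]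
    by (simp_all add: b_def card_S assms(6))
  have "real b \<le> 2 * real m"
    using b_le by linarith
  then have bound: "(3 * real k * real n - 2 * real m) / (2 * real k + 1) \<le> real ?\<gamma>"
    by (simp add: b pos_divide_le_eq algebra_simps)
  have "real ?\<gamma> = (3 * real k * real n - 2 * real m) / (2 * real k + 1) \<longleftrightarrow> real b = 2 * real m"
    by (auto simp: b eq_divide_eq algebra_simps)
  also have "\<dots> \<longleftrightarrow> 2 * m = b"
    by linarith
  finally have eq_iff:
    "real ?\<gamma> = (3 * real k * real n - 2 * real m) / (2 * real k + 1) \<longleftrightarrow> 2 * m = b" .
  \<comment> \<open>A given join yields some tight set \<open>X\<close> of size
    \<open>?\<gamma>\<close>, possibly different from \<open>S\<close>. This suffices, since the
    edge count of a tight partition depends only on the sizes of its parts.\<close>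
  have b_of_tight: "2 * m = b" if "tight_partition k G X" "card X = ?\<gamma>" for X
    using card_edges_tight_partition[OF assms(2) that(1)] card_T[of X] that
    by (simp add: b_def assms(6) tight_partition_def)
  show ?thesis
  proof (intro conjI bound iffI)
    assume "real ?\<gamma> = (3 * real k * real n - 2 * real m) / (2 * real k + 1)"
    then show "\<exists>(H :: nat ugraph) (F :: nat ugraph) K.
        simple_graph H \<and> regular_graph (k - 1) H \<and> card (verts H) = ?\<gamma> \<and>
        simple_graph F \<and> regular_graph k F \<and> card (verts F) = n - ?\<gamma> \<and>
        is_k_join k F H K \<and> ugraph_iso G K"
      using join_of_tight_partition[OF assms(2) tight k_le] card_T[OF sub card_S]
      by (simp add: eq_iff card_S)
  next
    assume "\<exists>(H :: nat ugraph) (F :: nat ugraph) K.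
        simple_graph H \<and> regular_graph (k - 1) H \<and> card (verts H) = ?\<gamma> \<and>
        simple_graph F \<and> regular_graph k F \<and> card (verts F) = n - ?\<gamma> \<and>
        is_k_join k F H K \<and> ugraph_iso G K"
    then obtain X where "tight_partition k G X" "card X = ?\<gamma>"
      using tight_partition_of_join by metis
    then show "real ?\<gamma> = (3 * real k * real n - 2 * real m) / (2 * real k + 1)"
      using b_of_tight eq_iff by blast
  qed
qed

end
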